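(* Let $G=(V,E,l)$ be a finite connected undirected simple metric graph, let $v^*\in V$, and let $\varepsilon>0$. Suppose that there exists $T\ge0$ such that, for every oriented edge $a\in\overrightarrow E$ and every $t\ge T$, the set $$X_a(t)=\{\,t-\tau:\tau\in\mathcal A_{t(a)},\ 0\le t-\tau\le l(a)\,\}$$ is an $\varepsilon$-net in $[0,l(a)]$, where $t(a)$ denotes the tail vertex of $a$. Then the branched dynamics $\mathcal W(G,v^* )$ is $\varepsilon$-saturated for every $t\ge T$. In particular, $\tau_s(\varepsilon)\le T$.
   Context: A metric graph $G=(V,E,l)$ is a graph $(V,E)$ with a length function $l:E\to\mathbb R_{>0}$; each edge $e$ is identified with an interval of length $l(e)$. Graphs are undirected and simple (no loops, at most one edge between two vertices). $\overrightarrow E$ is the set of oriented edges: each edge $\{u,w\}$ gives two oriented edges $u\to w$ and $w\to u$. For $a=(u\to w)$ put $t(a)=u$ (tail), $h(a)=w$ (head), $l(a)=l(\{u,w\})$. A walk from $v^*$ to $v$ is a finite sequence of vertices $(v_0,\dots,v_n)$ with $v_0=v^*$, $v_n=v$ and $\{v_{i-1},v_i\}\in E$ for all $i$; its metric length is $\sum_{i=1}^n l(\{v_{i-1},v_i\})$. The empty walk at $v^*$, of length $0$, is included. For $v\in V$, $\mathcal A_v$ is the set of metric lengths of all finite walks from $v^*$ to $v$; it is the set of times at which moving points are born at $v$. The dynamics $\mathcal W(G,v^* )$ (time $t\in\mathbb R_{\ge 0}$, space $V\cup\bigsqcup_{e\in E}e$, i.e. the metric graph): each moving point lies on an oriented edge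 and moves at unit speed toward its head. When a moving point reaches a vertex $v$, it is removed and new moving points are created at $v$, one on each oriented edge issuing from $v$ (including the reverse of the edge along which it arrived), each moving away from $v$ at unit speed. At time $0$ moving points are created at $v^*$ on all oriented edges issuing from $v^*$. The system is $\varepsilon$-saturated at time $t$ if the moving points at time $t$ form an $\varepsilon$-net of the metric graph (every point is within distance at most $\varepsilon$ of some moving point). The moment of permanent $\varepsilon$-saturation is $\tau_s(\varepsilon)=\inf\{t_0\ge0:\mathcal W(G,v^* )\text{ is }\varepsilon\text{-saturated at every }t\ge t_0\}$ (with $\inf\emptyset=+\infty$).
   Formalization: The graph is additionally assumed to have at least one edge; for the single vertex without edges the hypothesis on oriented edges is vacuous, but there are no moving points, so the claim fails. *)

theory Defs
  imports Complex_Main "HOL-Library.Extended_Real"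
begin

definition simple_graph :: "'v set \<Rightarrow> 'v set set \<Rightarrow> bool" where
  "simple_graph V E \<longleftrightarrow> (\<forall>e\<in>E. e \<subseteq> V \<and> card e = 2)"

definition metric_graph :: "'v set \<Rightarrow> 'v set set \<Rightarrow> ('v set \<Rightarrow> real) \<Rightarrow> bool" where
  "metric_graph V E l \<longleftrightarrow> simple_graph V E \<and> (\<forall>e\<in>E. l e > 0)"

text \<open>The oriented edge \<open>u \<rightarrow> w\<close> is the pair \<open>(u, w)\<close>.\<close>

definition arcs :: "'v set set \<Rightarrow> ('v \<times> 'v) set" where
  "arcs E = {(u, w). {u, w} \<in> E}"

abbreviation tail :: "'v \<times> 'v \<Rightarrow> 'v" where "tail a \<equiv> fst a"

abbreviation head :: "'v \<times> 'v \<Rightarrow> 'v" where "head a \<equiv> snd a"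

definition arc_length :: "('v set \<Rightarrow> real) \<Rightarrow> 'v \<times> 'v \<Rightarrow> real" where
  "arc_length l a = l {tail a, head a}"

definition walk :: "'v set \<Rightarrow> 'v set set \<Rightarrow> 'v \<Rightarrow> 'v \<Rightarrow> 'v list \<Rightarrow> bool" where
  "walk V E u v p \<longleftrightarrow> p \<noteq> [] \<and> set p \<subseteq> V \<and> hd p = u \<and> last p = v \<and>
     successively (\<lambda>x y. {x, y} \<in> E) p"

fun walk_length :: "('v set \<Rightarrow> real) \<Rightarrow> 'v list \<Rightarrow> real" where
  "walk_length l (u # w # p) = l {u, w} + walk_length l (w # p)"
| "walk_length l _ = 0"

definition connected_graph :: "'v set \<Rightarrow> 'v set set \<Rightarrow> bool" where
  "connected_graph V E \<longleftrightarrow> V \<noteq> {} \<and> (\<forall>u\<in>V. \<forall>v\<in>V. \<exists>p. walk V E u v p)"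

definition birth_times ::
  "'v set \<Rightarrow> 'v set set \<Rightarrow> ('v set \<Rightarrow> real) \<Rightarrow> 'v \<Rightarrow> 'v \<Rightarrow> real set" where
  "birth_times V E l vstar v = {walk_length l p | p. walk V E vstar v p}"

definition X_set ::
  "'v set \<Rightarrow> 'v set set \<Rightarrow> ('v set \<Rightarrow> real) \<Rightarrow> 'v \<Rightarrow> 'v \<times> 'v \<Rightarrow> real \<Rightarrow> real set" where
  "X_set V E l vstar a t =
     {t - \<tau> | \<tau>. \<tau> \<in> birth_times V E l vstar (tail a) \<and> 0 \<le> t - \<tau> \<and> t - \<tau> \<le> arc_length l a}"

text \<open>
  Points of the metric graph are given by barycentric coordinates with respect to the vertices:
  a vertex is its indicator function, and the point at distance \<open>x\<close> from the tail of an arc has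
  the weights \<open>1 - x / length\<close> at the tail and \<open>x / length\<close> at the head. The edges are thereby
  glued at their common end vertices, and an edge carries the same points in both orientations.
\<close>

definition vertex_point :: "'v \<Rightarrow> 'v \<Rightarrow> real" where
  "vertex_point v = (\<lambda>w. if w = v then 1 else 0)"

definition arc_point :: "('v set \<Rightarrow> real) \<Rightarrow> 'v \<times> 'v \<Rightarrow> real \<Rightarrow> 'v \<Rightarrow> real" where
  "arc_point l a x = (\<lambda>v. if v = tail a then 1 - x / arc_length l a
                          else if v = head a then x / arc_length l a else 0)"

definition graph_space :: "'v set \<Rightarrow> 'v set set \<Rightarrow> ('v set \<Rightarrow> real) \<Rightarrow> ('v \<Rightarrow> real) set" where
  "graph_space V E l =
     vertex_point ` V \<union> {arc_point l a x | a x. a \<in> arcs E \<and> 0 \<le> x \<and> x \<le> arc_length l a}"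

lemma arc_point_tail: "arc_point l a 0 = vertex_point (tail a)"
  by (auto simp: arc_point_def vertex_point_def)

lemma arc_point_reverse:
  assumes "metric_graph V E l" "(u, w) \<in> arcs E"
  shows "arc_point l (w, u) (arc_length l (w, u) - x) = arc_point l (u, w) x"
proof -
  have "card {u, w} = 2" "l {u, w} > 0"
    using assms by (auto simp: metric_graph_def simple_graph_def arcs_def)
  moreover from this have "u \<noteq> w" by auto
  ultimately show ?thesis
    by (auto simp: arc_point_def arc_length_def insert_commute fun_eq_iff diff_divide_distrib)
qed

text \<open>
  The length metric: a piecewise linear path moves, in each of its finitely many pieces, inside a
  single edge, and the distance of two points is the infimum of the lengths of such paths.
\<close>

inductive pl_path :: "'v set set \<Rightarrow> ('v set \<Rightarrow> real) \<Rightarrow> ('v \<Rightarrow> real) \<Rightarrow> ('v \<Rightarrow> real) \<Rightarrow> real \<Rightarrow> bool"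
  for E l where
  const: "pl_path E l p p 0"
| step: "pl_path E l p (arc_point l a x) r \<Longrightarrow> a \<in> arcs E \<Longrightarrow>
    0 \<le> x \<Longrightarrow> x \<le> arc_length l a \<Longrightarrow> 0 \<le> y \<Longrightarrow> y \<le> arc_length l a \<Longrightarrow>
    pl_path E l p (arc_point l a y) (r + \<bar>x - y\<bar>)"

definition graph_dist ::
  "'v set set \<Rightarrow> ('v set \<Rightarrow> real) \<Rightarrow> ('v \<Rightarrow> real) \<Rightarrow> ('v \<Rightarrow> real) \<Rightarrow> ereal" where
  "graph_dist E l p q = Inf {ereal r | r. pl_path E l p q r}"

text \<open>
  \<open>moving_point E l vstar t a x\<close>: at time \<open>t\<close> some moving point lies on the oriented edge \<open>a\<close> at
  distance \<open>x\<close> from its tail. Only \<open>x < arc_length l a\<close> occurs: at the instant of its arrival at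
  the head of \<open>a\<close> the point is replaced by new ones, at distance 0 from the tail of each oriented
  edge issuing from there. Multiplicities are not recorded.
\<close>

inductive moving_point ::
  "'v set set \<Rightarrow> ('v set \<Rightarrow> real) \<Rightarrow> 'v \<Rightarrow> real \<Rightarrow> 'v \<times> 'v \<Rightarrow> real \<Rightarrow> bool"
  for E l vstar where
  start: "a \<in> arcs E \<Longrightarrow> tail a = vstar \<Longrightarrow> moving_point E l vstar 0 a 0"
| move: "moving_point E l vstar t a x \<Longrightarrow> 0 \<le> s \<Longrightarrow> x + s < arc_length l a \<Longrightarrow>
    moving_point E l vstar (t + s) a (x + s)"
| branch: "moving_point E l vstar t a x \<Longrightarrow> b \<in> arcs E \<Longrightarrow> tail b = head a \<Longrightarrow>
    moving_point E l vstar (t + (arc_length l a - x)) b 0"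

definition moving_points_at ::
  "'v set set \<Rightarrow> ('v set \<Rightarrow> real) \<Rightarrow> 'v \<Rightarrow> real \<Rightarrow> ('v \<Rightarrow> real) set" where
  "moving_points_at E l vstar t = {arc_point l a x | a x. moving_point E l vstar t a x}"

definition eps_net :: "('a \<Rightarrow> 'a \<Rightarrow> ereal) \<Rightarrow> real \<Rightarrow> 'a set \<Rightarrow> 'a set \<Rightarrow> bool" where
  "eps_net d \<epsilon> N S \<longleftrightarrow> N \<subseteq> S \<and> (\<forall>x\<in>S. \<exists>y\<in>N. d x y \<le> ereal \<epsilon>)"

definition saturated ::
  "'v set \<Rightarrow> 'v set set \<Rightarrow> ('v set \<Rightarrow> real) \<Rightarrow> 'v \<Rightarrow> real \<Rightarrow> real \<Rightarrow> bool" where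
  "saturated V E l vstar \<epsilon> t \<longleftrightarrow>
     eps_net (graph_dist E l) \<epsilon> (moving_points_at E l vstar t) (graph_space V E l)"

definition saturation_time ::
  "'v set \<Rightarrow> 'v set set \<Rightarrow> ('v set \<Rightarrow> real) \<Rightarrow> 'v \<Rightarrow> real \<Rightarrow> ereal" where
  "saturation_time V E l vstar \<epsilon> =
     Inf {ereal t0 | t0. 0 \<le> t0 \<and> (\<forall>t\<ge>t0. saturated V E l vstar \<epsilon> t)}"

end

theory Submission imports Defs begin

text \<open>
  Every time \<open>\<tau>\<close> in \<open>birth_times\<close> of the tail of an arc \<open>a\<close> is a time at which a moving point is
  created at the start of \<open>a\<close>, as one sees by following the walk. At time \<open>t\<close> this point has
  coordinate \<open>t - \<tau>\<close> on \<open>a\<close>, or it has just been replaced at the head of \<open>a\<close> by new points, one of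
  them on the reverse of \<open>a\<close>. Hence all of \<open>X_set\<close> is occupied by moving points, and the graph
  distance along an edge is at most the difference of the coordinates.
\<close>

lemma arcs_reverse: "(u, w) \<in> arcs E \<longleftrightarrow> (w, u) \<in> arcs E"
  by (simp add: arcs_def insert_commute)

lemma arc_length_pos:
  assumes "metric_graph V E l" "a \<in> arcs E"
  shows "arc_length l a > 0"
  using assms by (auto simp: metric_graph_def arcs_def arc_length_def)

lemma walk_length_snoc:
  "p \<noteq> [] \<Longrightarrow> walk_length l (p @ [w]) = walk_length l p + l {last p, w}"
  by (induction l p rule: walk_length.induct) auto

text \<open>A path with a single piece inside the edge gives the bound. Only an inequality is
  claimed, as a detour through other edges may be shorter.\<close>

lemma graph_dist_arc_point_le:
  assumes "a \<in> arcs E" "x \<in> {0..arc_length l a}" "y \<in> {0..arc_length l a}"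
  shows "graph_dist E l (arc_point l a x) (arc_point l a y) \<le> ereal \<bar>x - y\<bar>"
proof -
  have "pl_path E l (arc_point l a x) (arc_point l a y) (0 + \<bar>x - y\<bar>)"
    using assms by (intro pl_path.step pl_path.const) auto
  then show ?thesis
    unfolding graph_dist_def by (auto intro: Inf_lower)
qed

text \<open>Points are created at coordinate 0, where the strict upper bound is positivity of the
  edge length; \<open>move\<close> carries its own bound.\<close>

lemma moving_point_on_arc:
  assumes "metric_graph V E l" "moving_point E l vstar t a x"
  shows "a \<in> arcs E \<and> 0 \<le> x \<and> x < arc_length l a"
  using assms(2) by induction (auto intro: arc_length_pos[OF assms(1)])

lemma moving_points_subset_graph_space:
  assumes "metric_graph V E l"
  shows "moving_points_at E l vstar t \<subseteq> graph_space V E l"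
  using moving_point_on_arc[OF assms]
  by (fastforce simp: moving_points_at_def graph_space_def)

lemma moving_point_born:
  assumes "walk V E vstar (tail b) p" "b \<in> arcs E"
  shows "moving_point E l vstar (walk_length l p) b 0"
  using assms
proof (induction p arbitrary: b rule: rev_induct)
  case Nil
  then show ?case by (simp add: walk_def)
next
  case (snoc w p)
  show ?case
  proof (cases "p = []")
    case True
    then show ?thesis using snoc.prems by (auto simp: walk_def intro: moving_point.start)
  next
    case False
    \<comment> \<open>The last edge of the walk: a point born at its tail on completion of
      \<open>p\<close> branches into \<open>b\<close> on reaching \<open>w\<close>. The induction
      hypothesis is used for this arc instead of \<open>b\<close>.\<close>
    define a where "a = (last p, w)"
    have "walk V E vstar (tail a) p" "a \<in> arcs E" and b: "tail b = head a"
      using snoc.prems False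
      by (auto simp: walk_def a_def arcs_def successively_append_iff)
    then have "moving_point E l vstar (walk_length l p + (arc_length l a - 0)) b 0"
      using snoc.IH snoc.prems(2) b by (intro moving_point.branch) auto
    then show ?thesis
      using False by (simp add: walk_length_snoc a_def arc_length_def)
  qed
qed

lemma X_set_occupied:
  assumes "metric_graph V E l" "a \<in> arcs E" "y \<in> X_set V E l vstar a t"
  shows "arc_point l a y \<in> moving_points_at E l vstar t"
proof -
  obtain p where p: "walk V E vstar (tail a) p" and y: "y = t - walk_length l p"
    "0 \<le> y" "y \<le> arc_length l a"
    using assms(3) by (auto simp: X_set_def birth_times_def)
  note born = moving_point_born[OF p assms(2), of l]
  show ?thesis
  proof (cases "y < arc_length l a")
    case True
    then have "moving_point E l vstar t a y"
      using moving_point.move[OF born, of y] y by simp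
    then show ?thesis unfolding moving_points_at_def by blast
  next
    case False
    obtain u w where a: "a = (u, w)" by fastforce
    have "y = arc_length l a" using False y by simp
    then have t: "t = walk_length l p + (arc_length l a - 0)" using y by simp
    \<comment> \<open>The reverse arc is an arc issuing from \<open>w\<close> that is sure to exist,
      and its start is the same point of the graph as the head of \<open>a\<close>.\<close>
    have "moving_point E l vstar t (w, u) 0"
      unfolding t using born assms(2) a
      by (intro moving_point.branch) (auto simp: arcs_reverse[of w u])
    moreover have "arc_point l a y = arc_point l (w, u) 0"
      using arc_point_reverse[OF assms(1), of u w y] assms(2) a \<open>y = arc_length l a\<close>
      by (simp add: arc_length_def insert_commute)
    ultimately show ?thesis unfolding moving_points_at_def by blast
  qed
qed

text \<open>An edge has two ends, so some vertex differs from \<open>v\<close>; a walk from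
  \<open>v\<close> to it must have a first edge.\<close>

lemma vertex_has_arc:
  assumes "simple_graph V E" "connected_graph V E" "E \<noteq> {}" "v \<in> V"
  obtains a where "a \<in> arcs E" "tail a = v"
proof -
  obtain e where "e \<subseteq> V" "card e = 2" using assms(1,3) by (auto simp: simple_graph_def)
  then obtain u where u: "u \<in> V" "u \<noteq> v" by (auto simp: card_2_iff)
  then obtain p where p: "walk V E v u p" using assms(2,4) by (auto simp: connected_graph_def)
  then obtain q where "p = v # q" by (cases p) (auto simp: walk_def)
  with p u obtain w q' where "p = v # w # q'" by (cases q) (auto simp: walk_def)
  with p have "(v, w) \<in> arcs E" by (auto simp: walk_def arcs_def)
  then show ?thesis using that by simp
qed

text \<open>This brings the vertices, too, within reach of a hypothesis that speaks only of
  arcs.\<close>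

lemma graph_space_on_arc:
  assumes "metric_graph V E l" "connected_graph V E" "E \<noteq> {}" "q \<in> graph_space V E l"
  obtains a x where "a \<in> arcs E" "x \<in> {0..arc_length l a}" "q = arc_point l a x"
proof -
  have "\<exists>a x. a \<in> arcs E \<and> x \<in> {0..arc_length l a} \<and> q = arc_point l a x"
  proof (cases "q \<in> vertex_point ` V")
    case True
    then obtain v where v: "v \<in> V" "q = vertex_point v" by auto
    obtain a where a: "a \<in> arcs E" "tail a = v"
      using vertex_has_arc assms v(1) by (metis metric_graph_def)
    then have "q = arc_point l a 0" "0 \<in> {0..arc_length l a}"
      using v arc_length_pos[OF assms(1) a(1)] by (auto simp: arc_point_tail)
    with a show ?thesis by blast
  next
    case False
    then show ?thesis using assms(4) by (auto simp: graph_space_def)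
  qed
  then show ?thesis using that by blast
qed

theorem lemma3p2:
  fixes V :: "'v set" and E :: "'v set set" and l :: "'v set \<Rightarrow> real"
    and vstar :: 'v and \<epsilon> T :: real
  assumes "metric_graph V E l" and "finite V" and "connected_graph V E"
    and "E \<noteq> {}"
    and "vstar \<in> V" and "\<epsilon> > 0" and "T \<ge> 0"
    and "\<And>a t. a \<in> arcs E \<Longrightarrow> t \<ge> T \<Longrightarrow>
      eps_net (\<lambda>x y. ereal \<bar>x - y\<bar>) \<epsilon> (X_set V E l vstar a t) {0..arc_length l a}"
  shows "(\<forall>t\<ge>T. saturated V E l vstar \<epsilon> t) \<and> saturation_time V E l vstar \<epsilon> \<le> ereal T"
proof -
  have sat: "saturated V E l vstar \<epsilon> t" if t: "t \<ge> T" for t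
    unfolding saturated_def eps_net_def
  proof (intro conjI ballI)
    show "moving_points_at E l vstar t \<subseteq> graph_space V E l"
      by (rule moving_points_subset_graph_space[OF assms(1)])
  next
    fix q assume "q \<in> graph_space V E l"
    then obtain a x where a: "a \<in> arcs E" and x: "x \<in> {0..arc_length l a}"
      and q: "q = arc_point l a x"
      using graph_space_on_arc assms(1,3,4) by metis
    \<comment> \<open>The interval bound on \<open>y\<close> is the inclusion part of
      \<open>eps_net\<close>; it keeps the path from \<open>x\<close> to \<open>y\<close> inside the
      edge.\<close>
    obtain y where y: "y \<in> X_set V E l vstar a t" "y \<in> {0..arc_length l a}"
      "ereal \<bar>x - y\<bar> \<le> ereal \<epsilon>"
      using assms(8)[OF a t] x unfolding eps_net_def by blast
    have "graph_dist E l q (arc_point l a y) \<le> ereal \<epsilon>"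
      using graph_dist_arc_point_le[OF a x y(2)] y(3) q by (auto intro: order_trans)
    then show "\<exists>r\<in>moving_points_at E l vstar t. graph_dist E l q r \<le> ereal \<epsilon>"
      using X_set_occupied[OF assms(1) a y(1)] by blast
  qed
  \<comment> \<open>\<open>T\<close> is itself one of the times whose infimum is taken.\<close>
  moreover have "saturation_time V E l vstar \<epsilon> \<le> ereal T"
    unfolding saturation_time_def using sat assms(7) by (intro Inf_lower) auto
  ultimately show ?thesis by blast
qed

end
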